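(* Up to inner automorphism, the subalgebras of $A_2$ isomorphic to the $2$-dimensional nonabelian Lie algebra $K_2$ are classified by the list $$\begin{array}{l} K_2^1=\langle x_1+x_2,\ h_1+h_2\rangle,\\ K_2^2=\langle x_1,\ -\tfrac13h_1+\tfrac13h_2+x_3\rangle,\\ K_2^3=\langle x_1,\ -\tfrac23h_1-\tfrac13h_2+y_2\rangle,\\ K_2^{4,\alpha}=\langle x_1,\ \alpha h_1+(2\alpha+1)h_2\rangle\quad(\alpha\in\mathbb{C}). \end{array}$$ That is, each listed subalgebra is isomorphic to $K_2$, every subalgebra of $A_2$ isomorphic to $K_2$ is equivalent to one on the list, and the listed subalgebras are pairwise inequivalent; in particular $K_2^{4,\alpha}\sim K_2^{4,\beta}$ if and only if $\alpha=\beta$.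
   Context: $A_2$ is the Lie algebra of traceless $3\times3$ complex matrices. Its Chevalley basis $x_i,y_i$ ($1\le i\le 3$), $h_1,h_2$ is defined by $$ah_1+bh_2+cx_1+dx_2+ex_3+c'y_1+d'y_2+e'y_3=\begin{pmatrix} a & c & -e\\ c' & b-a & d\\ -e' & d' & -b\end{pmatrix}.$$ $\langle W_1,\dots,W_m\rangle$ denotes the Lie subalgebra of $A_2$ generated by $W_1,\dots,W_m$. Two subalgebras are equivalent (written $\sim$) if an inner automorphism of $A_2$ maps one onto the other, i.e. if they are conjugate by an element of $\mathrm{SL}(3,\mathbb{C})$. $K_2$ is the complex Lie algebra with basis $z_1,z_2$ and $[z_1,z_2]=z_1$. *)

theory Defs
  imports "HOL-Analysis.Analysis"
begin

type_synonym mat3 = "complex^3^3"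

text \<open>The library scales a matrix only by reals (\<open>*\<^sub>R\<close>); subspaces and linear maps here are
  over the complex numbers.\<close>

definition mscale :: "complex \<Rightarrow> mat3 \<Rightarrow> mat3"  (infixr "*\<^sub>m" 75)
  where "c *\<^sub>m A = (\<chi> i j. c * A $ i $ j)"

interpretation mat3: vector_space mscale
  by unfold_locales (simp_all add: mscale_def vec_eq_iff algebra_simps)

definition lie_bracket :: "mat3 \<Rightarrow> mat3 \<Rightarrow> mat3"
  where "lie_bracket A B = A ** B - B ** A"

definition A2 :: "mat3 set"
  where "A2 = {A. trace A = 0}"

definition lie_subalgebra :: "mat3 set \<Rightarrow> bool"
  where "lie_subalgebra S \<longleftrightarrow>
    S \<subseteq> A2 \<and> mat3.subspace S \<and> (\<forall>A\<in>S. \<forall>B\<in>S. lie_bracket A B \<in> S)"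

definition generated :: "mat3 set \<Rightarrow> mat3 set"
  where "generated W = lie_subalgebra hull W"

definition A2_matrix :: "complex \<Rightarrow> complex \<Rightarrow> complex \<Rightarrow> complex \<Rightarrow> complex \<Rightarrow>
    complex \<Rightarrow> complex \<Rightarrow> complex \<Rightarrow> mat3"
  where "A2_matrix a b c d e c' d' e' =
    vector [vector [  a,    c, - e],
            vector [ c', b - a,  d],
            vector [- e',   d', - b]]"

definition h1 :: mat3 where "h1 = A2_matrix 1 0 0 0 0 0 0 0"
definition h2 :: mat3 where "h2 = A2_matrix 0 1 0 0 0 0 0 0"
definition x1 :: mat3 where "x1 = A2_matrix 0 0 1 0 0 0 0 0"
definition x2 :: mat3 where "x2 = A2_matrix 0 0 0 1 0 0 0 0"
definition x3 :: mat3 where "x3 = A2_matrix 0 0 0 0 1 0 0 0"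
definition y1 :: mat3 where "y1 = A2_matrix 0 0 0 0 0 1 0 0"
definition y2 :: mat3 where "y2 = A2_matrix 0 0 0 0 0 0 1 0"
definition y3 :: mat3 where "y3 = A2_matrix 0 0 0 0 0 0 0 1"

lemma A2_matrix_eq:
  "a *\<^sub>m h1 + b *\<^sub>m h2 + c *\<^sub>m x1 + d *\<^sub>m x2 + e *\<^sub>m x3 + c' *\<^sub>m y1 + d' *\<^sub>m y2 + e' *\<^sub>m y3
    = A2_matrix a b c d e c' d' e'"
  by (simp add: vec_eq_iff forall_3 mscale_def A2_matrix_def
      h1_def h2_def x1_def x2_def x3_def y1_def y2_def y3_def)

definition inner_automorphism :: "(mat3 \<Rightarrow> mat3) \<Rightarrow> bool"
  where "inner_automorphism f \<longleftrightarrow> (\<exists>P. det P = 1 \<and> f = (\<lambda>A. P ** A ** matrix_inv P))"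

definition equivalent :: "mat3 set \<Rightarrow> mat3 set \<Rightarrow> bool"  (infix "\<sim>\<^sub>L" 50)
  where "S \<sim>\<^sub>L T \<longleftrightarrow> (\<exists>f. inner_automorphism f \<and> f ` S = T)"

text \<open>The Lie algebra \<open>K\<^sub>2\<close> is modelled on \<open>complex^2\<close>, with \<open>z\<^sub>1\<close> and \<open>z\<^sub>2\<close> the standard basis;
  its bracket is the bilinear alternating extension of \<open>[z\<^sub>1, z\<^sub>2] = z\<^sub>1\<close>.\<close>

definition K2_bracket :: "complex^2 \<Rightarrow> complex^2 \<Rightarrow> complex^2"
  where "K2_bracket u v = vector [u $ 1 * v $ 2 - u $ 2 * v $ 1, 0]"

lemma K2_bracket_basis: "K2_bracket (axis 1 1) (axis 2 1) = axis 1 1"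
  by (simp add: vec_eq_iff forall_2 K2_bracket_def axis_def)

lemma K2_bracket_lie:
  "K2_bracket (a *s u + v) w = a *s K2_bracket u w + K2_bracket v w"
  "K2_bracket w (a *s u + v) = a *s K2_bracket w u + K2_bracket w v"
  "K2_bracket u u = 0"
  "K2_bracket u (K2_bracket v w) + K2_bracket v (K2_bracket w u) + K2_bracket w (K2_bracket u v) = 0"
  by (simp_all add: vec_eq_iff forall_2 K2_bracket_def algebra_simps)

definition isomorphic_K2 :: "mat3 set \<Rightarrow> bool"
  where "isomorphic_K2 S \<longleftrightarrow>
    (\<exists>f. Vector_Spaces.linear (*s) mscale f \<and> bij_betw f UNIV S \<and>
      (\<forall>u v. f (K2_bracket u v) = lie_bracket (f u) (f v)))"

datatype K2_label = L1 | L2 | L3 | L4 complex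

fun K2_sub :: "K2_label \<Rightarrow> mat3 set" where
  "K2_sub L1 = generated {x1 + x2, h1 + h2}"
| "K2_sub L2 = generated {x1, (- 1/3) *\<^sub>m h1 + (1/3) *\<^sub>m h2 + x3}"
| "K2_sub L3 = generated {x1, (- 2/3) *\<^sub>m h1 + (- 1/3) *\<^sub>m h2 + y2}"
| "K2_sub (L4 \<alpha>) = generated {x1, \<alpha> *\<^sub>m h1 + (2 * \<alpha> + 1) *\<^sub>m h2}"

end

theory Submission
  imports Defs
begin

text \<open>
  A copy of \<open>K\<^sub>2\<close> in \<open>A\<^sub>2\<close> is the span of a pair \<open>X \<noteq> 0\<close>, \<open>Y\<close> with \<open>[X, Y] = X\<close>. This relation makes
  the traces of all powers of \<open>X\<close> vanish, so \<open>X\<close> is nilpotent and can be brought to Jordan form: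
  \<open>x\<^sub>1 + x\<^sub>2\<close> if \<open>X\<^sup>2 \<noteq> 0\<close> and \<open>x\<^sub>1\<close> otherwise. Then \<open>[X, Y] = X\<close> is a linear system that leaves few
  entries of \<open>Y\<close> free, and the matrices commuting with \<open>X\<close> up to a scalar remove what is left. For
  \<open>X = x\<^sub>1\<close> the eigenvalues of \<open>Y\<close> are \<open>a\<close>, \<open>a + 1\<close>, \<open>- (2 * a + 1)\<close>; two of them coincide, and \<open>Y\<close>
  can fail to be diagonalizable, when \<open>a = - 1/3\<close> or \<open>a = - 2/3\<close>, which gives \<open>L2\<close> and \<open>L3\<close>.

  A conjugation between two such spans preserves the line of \<open>X\<close>, the derived algebra, and maps \<open>Y\<close>
  to \<open>Y' + d X'\<close>. Hence the rank of \<open>X\<close> separates \<open>L1\<close> from the rest, and otherwise the eigenvalue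
  \<open>a\<close> of \<open>Y\<close> on the image of \<open>X\<close> is an invariant. The unordered spectrum of \<open>Y\<close> would not suffice:
  it is the same for \<open>L4 0\<close> and \<open>L4 (- 1)\<close>.
\<close>

section \<open>Matrix identities, checked entry by entry\<close>

lemmas entrywise = vec_eq_iff forall_3 sum_3 matrix_matrix_mult_def mscale_def

text \<open>The bracket is bilinear and alternating, so on a span of two matrices it is scaled by
  the determinant of the coefficients.\<close>

lemma lie_bracket_lincomb:
  "lie_bracket (a *\<^sub>m X + b *\<^sub>m Y) (c *\<^sub>m X + d *\<^sub>m Y) = (a * d - b * c) *\<^sub>m lie_bracket X Y"
  unfolding lie_bracket_def by (simp add: entrywise algebra_simps)

lemma trace_lincomb: "trace (a *\<^sub>m X + b *\<^sub>m Y) = a * trace X + b * trace Y"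
  by (simp add: trace_def sum_3 mscale_def algebra_simps)

lemma mult_mscale: "X ** (c *\<^sub>m Y) = c *\<^sub>m (X ** Y)"
  and mscale_mult: "(c *\<^sub>m X) ** Y = c *\<^sub>m (X ** Y)"
  by (simp_all add: entrywise algebra_simps)

lemma matrix_add_mult: "(X + Y) ** Z = X ** Z + Y ** Z" for X Y Z :: mat3
  by (simp add: entrywise algebra_simps)

lemma matrix_mult_diff: "X ** (Y - Z) = X ** Y - X ** Z" "(Y - Z) ** X = Y ** X - Z ** X" for X Y Z :: mat3
  by (simp_all add: entrywise algebra_simps)

lemma det_mscale: "det (c *\<^sub>m P) = c ^ 3 * det P"
  by (simp add: det_3 mscale_def algebra_simps power3_eq_cube)

lemma in_span_pair: "A \<in> mat3.span {X, Y} \<longleftrightarrow> (\<exists>a b. A = a *\<^sub>m X + b *\<^sub>m Y)"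
proof
  assume "A \<in> mat3.span {X, Y}"
  then obtain a where "A - a *\<^sub>m X \<in> mat3.span {Y}"
    by (metis mat3.span_breakdown_eq)
  then obtain b where "A - a *\<^sub>m X = b *\<^sub>m Y"
    by (auto simp: mat3.span_singleton)
  then have "A = a *\<^sub>m X + b *\<^sub>m Y" by (metis diff_eq_eq add.commute)
  then show "\<exists>a b. A = a *\<^sub>m X + b *\<^sub>m Y" by blast
next
  assume "\<exists>a b. A = a *\<^sub>m X + b *\<^sub>m Y"
  then show "A \<in> mat3.span {X, Y}"
    by (metis mat3.span_add mat3.span_scale mat3.span_base insertI1 insertI2)
qed

lemma matrix_inv_inverse:
  fixes P :: mat3
  assumes "det P \<noteq> 0"
  shows "matrix_inv P ** P = mat 1" "P ** matrix_inv P = mat 1"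
proof -
  have "\<exists>Q. P ** Q = mat 1 \<and> Q ** P = mat 1"
    using assms by (simp add: invertible_det_nz[symmetric] invertible_def)
  from someI_ex[OF this] show "matrix_inv P ** P = mat 1" "P ** matrix_inv P = mat 1"
    unfolding matrix_inv_def by auto
qed

section \<open>Copies of \<open>K\<^sub>2\<close> as spans of pairs with [X, Y] = X\<close>

text \<open>\<open>X\<close> and \<open>Y\<close> are the images of z_1 and z_2 under an embedding.
  As a commutator, \<open>X\<close> has trace 0 by itself.\<close>

definition K2_pair :: "mat3 \<Rightarrow> mat3 \<Rightarrow> bool"
  where "K2_pair X Y \<longleftrightarrow> X \<noteq> 0 \<and> trace Y = 0 \<and> lie_bracket X Y = X"

lemma K2_pair_trace: "K2_pair X Y \<Longrightarrow> trace X = 0"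
  using trace_mul_sym[of X Y] trace_sub[of "X ** Y" "Y ** X"]
  by (auto simp: K2_pair_def lie_bracket_def)

text \<open>Bracketing with \<open>X\<close> kills the \<open>X\<close> part and turns
  \<open>b *\<^sub>m Y\<close> into \<open>b *\<^sub>m X\<close>, so it reads off the coefficient of
  \<open>Y\<close>.\<close>

lemma K2_pair_independent:
  assumes "K2_pair X Y" "a *\<^sub>m X + b *\<^sub>m Y = c *\<^sub>m X + d *\<^sub>m Y"
  shows "a = c \<and> b = d"
proof -
  have X: "X \<noteq> 0" "lie_bracket X Y = X" using assms(1) by (auto simp: K2_pair_def)
  have "lie_bracket (1 *\<^sub>m X + 0 *\<^sub>m Y) (a *\<^sub>m X + b *\<^sub>m Y)
      = lie_bracket (1 *\<^sub>m X + 0 *\<^sub>m Y) (c *\<^sub>m X + d *\<^sub>m Y)"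
    using assms(2) by simp
  then have "b *\<^sub>m X = d *\<^sub>m X" unfolding lie_bracket_lincomb X by simp
  then have "b = d" using X(1) mat3.scale_right_imp_eq by blast
  then have "a *\<^sub>m X = c *\<^sub>m X" using assms(2) by simp
  then show ?thesis using \<open>b = d\<close> X(1) mat3.scale_right_imp_eq by blast
qed

lemma lie_subalgebra_span:
  assumes "K2_pair X Y"
  shows "lie_subalgebra (mat3.span {X, Y})"
  unfolding lie_subalgebra_def
proof (intro conjI ballI)
  show "mat3.span {X, Y} \<subseteq> A2"
    using assms K2_pair_trace[OF assms]
    by (auto simp: in_span_pair A2_def trace_lincomb K2_pair_def)
  fix A B assume "A \<in> mat3.span {X, Y}" "B \<in> mat3.span {X, Y}"
  then obtain a b c d where "A = a *\<^sub>m X + b *\<^sub>m Y" "B = c *\<^sub>m X + d *\<^sub>m Y"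
    by (auto simp: in_span_pair)
  then have "lie_bracket A B = (a * d - b * c) *\<^sub>m X + 0 *\<^sub>m Y"
    using assms by (simp add: lie_bracket_lincomb K2_pair_def)
  then show "lie_bracket A B \<in> mat3.span {X, Y}"
    unfolding in_span_pair by blast
qed simp

text \<open>The factor \<open>g\<close> allows for a listed generator that satisfies [X, Y] = X only
  after rescaling.\<close>

lemma generated_eq_span:
  assumes "K2_pair X Y" "g \<noteq> 0"
  shows "generated {X, g *\<^sub>m Y} = mat3.span {X, Y}"
  unfolding generated_def
proof (rule hull_unique)
  show "{X, g *\<^sub>m Y} \<subseteq> mat3.span {X, Y}"
    by (auto intro: mat3.span_scale mat3.span_base)
  show "lie_subalgebra (mat3.span {X, Y})" by (rule lie_subalgebra_span[OF assms(1)])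
  fix T assume T: "{X, g *\<^sub>m Y} \<subseteq> T" "lie_subalgebra T"
  then have sub: "mat3.subspace T" by (simp add: lie_subalgebra_def)
  then have "inverse g *\<^sub>m (g *\<^sub>m Y) \<in> T"
    using T(1) mat3.subspace_scale by blast
  then have "Y \<in> T" using assms(2) by simp
  then show "mat3.span {X, Y} \<subseteq> T" using T(1) sub by (simp add: mat3.span_minimal)
qed

lemma isomorphic_K2_span:
  assumes "K2_pair X Y"
  shows "isomorphic_K2 (mat3.span {X, Y})"
proof -
  define f where "f = (\<lambda>u :: complex^2. u $ 1 *\<^sub>m X + u $ 2 *\<^sub>m Y)"
  have "Vector_Spaces.linear (*s) mscale f"
    by unfold_locales (simp_all add: f_def entrywise algebra_simps)
  moreover have "bij_betw f UNIV (mat3.span {X, Y})"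
  proof (rule bij_betwI')
    fix u v show "f u = f v \<longleftrightarrow> u = v"
      using K2_pair_independent[OF assms, of "u $ 1" "u $ 2" "v $ 1" "v $ 2"]
      unfolding f_def vec_eq_iff forall_2 by metis
  next
    fix A assume "A \<in> mat3.span {X, Y}"
    then obtain a b where "A = a *\<^sub>m X + b *\<^sub>m Y" by (auto simp: in_span_pair)
    then have "A = f (vector [a, b])" by (simp add: f_def)
    then show "\<exists>u\<in>UNIV. A = f u" by blast
  qed (auto simp: f_def in_span_pair)
  moreover have "f (K2_bracket u v) = lie_bracket (f u) (f v)" for u v
    using assms by (simp add: f_def lie_bracket_lincomb K2_bracket_def K2_pair_def)
  ultimately show ?thesis unfolding isomorphic_K2_def by blast
qed

lemma isomorphic_K2_obtain:
  assumes "lie_subalgebra S" "isomorphic_K2 S"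
  obtains X Y where "K2_pair X Y" "S = mat3.span {X, Y}"
proof -
  obtain f where lin: "Vector_Spaces.linear (*s) mscale f" and bij: "bij_betw f UNIV S"
    and br: "\<And>u v. f (K2_bracket u v) = lie_bracket (f u) (f v)"
    using assms(2) unfolding isomorphic_K2_def by blast
  interpret f: Vector_Spaces.linear "(*s)" mscale f by (rule lin)
  define X Y where "X = f (axis 1 1)" and "Y = f (axis 2 1)"
  have "f u = u $ 1 *\<^sub>m X + u $ 2 *\<^sub>m Y" for u
  proof -
    have "u = u $ 1 *s axis 1 1 + u $ 2 *s axis 2 1"
      by (simp add: vec_eq_iff forall_2 axis_def)
    then show ?thesis by (metis X_def Y_def f.add f.scale)
  qed
  then have f_eq: "f = (\<lambda>u. u $ 1 *\<^sub>m X + u $ 2 *\<^sub>m Y)" by blast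
  have "S = mat3.span {X, Y}"
  proof (intro set_eqI iffI)
    fix A assume "A \<in> S"
    then show "A \<in> mat3.span {X, Y}"
      using bij unfolding bij_betw_def f_eq by (auto simp: in_span_pair)
  next
    fix A assume "A \<in> mat3.span {X, Y}"
    then obtain a b where "A = a *\<^sub>m X + b *\<^sub>m Y" by (auto simp: in_span_pair)
    then have "A = f (vector [a, b])" by (simp add: f_eq)
    then show "A \<in> S" using bij by (auto simp: bij_betw_def)
  qed
  moreover have "K2_pair X Y"
    unfolding K2_pair_def
  proof (intro conjI)
    have "axis 1 1 \<noteq> (0 :: complex^2)" by (simp add: axis_eq_0_iff)
    then show "X \<noteq> 0"
      using bij f.zero unfolding X_def bij_betw_def inj_on_def by (metis UNIV_I)
    have "Y \<in> S" using bij by (auto simp: Y_def bij_betw_def)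
    then show "trace Y = 0" using assms(1) by (auto simp: lie_subalgebra_def A2_def)
    show "lie_bracket X Y = X" using br K2_bracket_basis by (metis X_def Y_def)
  qed
  ultimately show thesis using that by blast
qed

section \<open>Equivalence of spans in terms of intertwining matrices\<close>

text \<open>Conjugation by the inverse of \<open>P\<close> carries the first span onto the second.
  The intertwining form keeps inverses out of later computations, and any invertible
  \<open>P\<close> may be used because a scalar factor does not change the conjugation.\<close>

lemma equivalent_spanI:
  assumes "det P \<noteq> 0" "c \<noteq> 0" and X: "X ** P = P ** (c *\<^sub>m X')"
    and Y: "Y ** P = P ** (Y' + d *\<^sub>m X')"
  shows "mat3.span {X, Y} \<sim>\<^sub>L mat3.span {X', Y'}"
proof -
  let ?Q = "matrix_inv P"
  note PQ = matrix_inv_inverse[OF assms(1)]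
  have "det ?Q * det P = 1" by (simp flip: det_mul add: PQ)
  \<comment> \<open>Scaling by \<open>k\<close> multiplies a determinant by \<open>k ^ 3\<close>, so
    a cube root of \<open>det P\<close> gives \<open>k *\<^sub>m ?Q\<close> determinant 1.\<close>
  obtain k :: complex where k: "k ^ 3 = det P"
    using exists_complex_root[of 3 "det P"] by (metis zero_neq_numeral)
  then have k0: "k \<noteq> 0" using assms(1) by auto
  define R where "R = k *\<^sub>m ?Q"
  have detR: "det R = 1"
    using \<open>det ?Q * det P = 1\<close> by (simp add: R_def det_mscale k mult.commute)
  have R_inv: "matrix_inv R = inverse k *\<^sub>m P"
  proof -
    have "R ** (inverse k *\<^sub>m P) = mat 1"
      using k0 by (simp add: R_def mult_mscale mscale_mult PQ)
    then show ?thesis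
      by (metis detR matrix_inv_inverse(1) matrix_mul_assoc matrix_mul_lid matrix_mul_rid zero_neq_one)
  qed
  define f where "f = (\<lambda>A. R ** A ** matrix_inv R)"
  have f_eq: "f A = ?Q ** (A ** P)" for A
    using k0 by (simp add: f_def R_inv) (simp add: R_def mult_mscale mscale_mult matrix_mul_assoc)
  have fX: "f X = c *\<^sub>m X'" unfolding f_eq X by (simp add: matrix_mul_assoc PQ)
  have fY: "f Y = Y' + d *\<^sub>m X'" unfolding f_eq Y by (simp add: matrix_mul_assoc PQ)
  have f_lin: "f (a *\<^sub>m X + b *\<^sub>m Y) = (a * c + b * d) *\<^sub>m X' + b *\<^sub>m Y'" for a b
  proof -
    have "f (a *\<^sub>m X + b *\<^sub>m Y) = a *\<^sub>m f X + b *\<^sub>m f Y"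
      by (simp add: f_eq matrix_add_mult matrix_add_ldistrib mult_mscale mscale_mult)
    also have "\<dots> = (a * c + b * d) *\<^sub>m X' + b *\<^sub>m Y'"
      unfolding fX fY by (simp add: entrywise algebra_simps)
    finally show ?thesis .
  qed
  have "f ` mat3.span {X, Y} = mat3.span {X', Y'}"
  proof (intro set_eqI iffI)
    fix A assume "A \<in> f ` mat3.span {X, Y}"
    then obtain a b where "A = f (a *\<^sub>m X + b *\<^sub>m Y)" by (auto simp: in_span_pair)
    then show "A \<in> mat3.span {X', Y'}" unfolding f_lin in_span_pair by blast
  next
    fix A assume "A \<in> mat3.span {X', Y'}"
    then obtain a b where "A = a *\<^sub>m X' + b *\<^sub>m Y'" by (auto simp: in_span_pair)
    then have "A = f (((a - b * d) / c) *\<^sub>m X + b *\<^sub>m Y)" using assms(2) by (simp add: f_lin)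
    moreover have "((a - b * d) / c) *\<^sub>m X + b *\<^sub>m Y \<in> mat3.span {X, Y}"
      unfolding in_span_pair by blast
    ultimately show "A \<in> f ` mat3.span {X, Y}" by (rule image_eqI)
  qed
  then show ?thesis
    unfolding equivalent_def inner_automorphism_def f_def using detR by blast
qed

text \<open>A conjugation respects brackets, and the only pairs in the target span with [U, V] = U
  and U nonzero are U = c X', V = Y' + d X' with c nonzero.\<close>

lemma equivalent_spanE:
  assumes "mat3.span {X, Y} \<sim>\<^sub>L mat3.span {X', Y'}" "K2_pair X Y" "K2_pair X' Y'"
  obtains P c d where "det P \<noteq> 0" "c \<noteq> 0" "P ** X = (c *\<^sub>m X') ** P"
    "P ** Y = (Y' + d *\<^sub>m X') ** P"
proof -
  obtain P where P: "det P = 1"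
    and im: "(\<lambda>A. P ** A ** matrix_inv P) ` mat3.span {X, Y} = mat3.span {X', Y'}"
    using assms(1) unfolding equivalent_def inner_automorphism_def by blast
  define f where "f = (\<lambda>A. P ** A ** matrix_inv P)"
  have "det P \<noteq> 0" using P by simp
  note PQ = matrix_inv_inverse[OF this]
  have fP: "f A ** P = P ** A" for A
    by (simp add: f_def PQ matrix_mul_assoc[symmetric])
  have f_mult: "f A ** f B = f (A ** B)" for A B
  proof -
    have "f A ** f B = P ** A ** (matrix_inv P ** P) ** B ** matrix_inv P"
      unfolding f_def matrix_mul_assoc ..
    then show ?thesis unfolding PQ by (simp add: f_def matrix_mul_assoc)
  qed
  have "f X \<in> mat3.span {X', Y'}" "f Y \<in> mat3.span {X', Y'}"
    using im unfolding f_def by (auto intro: mat3.span_base)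
  then obtain a b d e where fX: "f X = a *\<^sub>m X' + b *\<^sub>m Y'" and fY: "f Y = d *\<^sub>m X' + e *\<^sub>m Y'"
    by (auto simp: in_span_pair)
  have "lie_bracket (f X) (f Y) = f (lie_bracket X Y)"
    unfolding lie_bracket_def f_mult unfolding f_def by (simp add: matrix_mult_diff)
  also have "\<dots> = f X" using assms(2) by (simp add: K2_pair_def)
  finally have "(a * e - b * d) *\<^sub>m X' + 0 *\<^sub>m Y' = a *\<^sub>m X' + b *\<^sub>m Y'"
    using assms(3) unfolding fX fY lie_bracket_lincomb by (simp add: K2_pair_def)
  \<comment> \<open>The bracket of the two images is a multiple of \<open>X'\<close>, so
    \<open>f X\<close> has no \<open>Y'\<close> component; comparing coefficients of
    \<open>X'\<close> then gives \<open>e = 1\<close> once \<open>a\<close> is nonzero.\<close>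
  then have ab: "a * e - b * d = a" "b = 0"
    using K2_pair_independent[OF assms(3)] by blast+
  have "a \<noteq> 0"
  proof
    assume "a = 0"
    then have "P ** X = 0" using fP[of X] ab by (simp add: fX)
    then have "matrix_inv P ** P ** X = 0" by (simp flip: matrix_mul_assoc)
    then show False using assms(2) by (simp add: PQ K2_pair_def)
  qed
  then have "e = 1" using ab by simp
  show thesis
  proof (rule that)
    show "det P \<noteq> 0" "a \<noteq> 0" by fact+
    show "P ** X = (a *\<^sub>m X') ** P" unfolding fP[symmetric] fX ab by simp
    show "P ** Y = (Y' + d *\<^sub>m X') ** P"
      unfolding fP[symmetric] fY \<open>e = 1\<close> by (simp add: add.commute)
  qed
qed

section \<open>The listed subalgebras and their inequivalence\<close>

text \<open>All labels other than \<open>L1\<close> share the matrix \<open>x1\<close>; below,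
  \<open>K2_X L2\<close> stands for it.\<close>

fun K2_X :: "K2_label \<Rightarrow> mat3" where
  "K2_X L1 = A2_matrix 0 0 1 1 0 0 0 0"
| "K2_X _ = A2_matrix 0 0 1 0 0 0 0 0"

text \<open>For \<open>L1\<close> the second generator is negated, because \<open>[x\<^sub>1 + x\<^sub>2, h\<^sub>1 + h\<^sub>2] = - (x\<^sub>1 + x\<^sub>2)\<close>.\<close>

fun K2_Y :: "K2_label \<Rightarrow> mat3" where
  "K2_Y L1 = A2_matrix (- 1) (- 1) 0 0 0 0 0 0"
| "K2_Y L2 = A2_matrix (- 1/3) (1/3) 0 0 1 0 0 0"
| "K2_Y L3 = A2_matrix (- 2/3) (- 1/3) 0 0 0 0 1 0"
| "K2_Y (L4 \<alpha>) = A2_matrix \<alpha> (2 * \<alpha> + 1) 0 0 0 0 0 0"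

lemma K2_pair_label: "K2_pair (K2_X l) (K2_Y l)"
  by (cases l)
    (auto simp: K2_pair_def lie_bracket_def trace_def A2_matrix_def entrywise algebra_simps)

lemma K2_sub_eq_span: "K2_sub l = mat3.span {K2_X l, K2_Y l}"
proof -
  have "generated {K2_X l, (if l = L1 then - 1 else 1) *\<^sub>m K2_Y l} = mat3.span {K2_X l, K2_Y l}"
    by (rule generated_eq_span[OF K2_pair_label]) simp
  moreover have "K2_sub l = generated {K2_X l, (if l = L1 then - 1 else 1) *\<^sub>m K2_Y l}"
    by (cases l) (auto intro!: arg_cong[of _ _ generated] arg_cong2[of _ _ _ _ insert]
        simp: A2_matrix_def entrywise h1_def h2_def x1_def x2_def x3_def y2_def)
  ultimately show ?thesis by simp
qed

lemma K2_sub_equivalent_imp_eq: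
  assumes "K2_sub l \<sim>\<^sub>L K2_sub m"
  shows "l = m"
proof -
  obtain P c d where P: "det P \<noteq> 0" "c \<noteq> 0" "P ** K2_X l = (c *\<^sub>m K2_X m) ** P"
    "P ** K2_Y l = (K2_Y m + d *\<^sub>m K2_X m) ** P"
    using equivalent_spanE[OF assms[unfolded K2_sub_eq_span] K2_pair_label K2_pair_label] by blast
  have L1: "l = L1 \<longleftrightarrow> m = L1"
  proof (rule ccontr)
    assume "\<not> (l = L1 \<longleftrightarrow> m = L1)"
    then consider "K2_X l = K2_X L1" "K2_X m = K2_X L2" | "K2_X l = K2_X L2" "K2_X m = K2_X L1"
      by (cases l; cases m) auto
    \<comment> \<open>The ranks of the two matrices are 2 and 1 in some order. The entries of the
      intertwining relation force a whole column or row of \<open>P\<close> to vanish.\<close>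
    then show False
    proof cases
      case 1
      have "P $ 1 $ 1 = 0 \<and> P $ 2 $ 1 = 0 \<and> P $ 3 $ 1 = 0"
        using P(2,3) unfolding 1 by (auto simp: A2_matrix_def entrywise)
      then show False using P(1) by (simp add: det_3)
    next
      case 2
      have "P $ 3 $ 1 = 0 \<and> P $ 3 $ 2 = 0 \<and> P $ 3 $ 3 = 0"
        using P(2,3) unfolding 2 by (auto simp: A2_matrix_def entrywise)
      then show False using P(1) by (simp add: det_3)
    qed
  qed
  show ?thesis
  proof (cases "l = L1")
    case True
    then show ?thesis using L1 by simp
  next
    case False
    then have X: "K2_X l = K2_X L2" "K2_X m = K2_X L2"
      using L1 by (cases l; cases m; simp)+
    \<comment> \<open>\<open>P\<close> commutes with \<open>x1\<close> up to a scalar. The resulting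
      zeros reduce \<open>det P\<close> to the product of the diagonal entries.\<close>
    have zero: "P $ 2 $ 1 = 0" "P $ 3 $ 1 = 0" "P $ 2 $ 3 = 0"
      using P(2,3) unfolding X by (auto simp: A2_matrix_def entrywise)
    then have nz: "P $ 1 $ 1 \<noteq> 0" "P $ 2 $ 2 \<noteq> 0" "P $ 3 $ 3 \<noteq> 0"
      using P(1) by (auto simp: det_3)
    have entry: "(P ** K2_Y l) $ i $ j = ((K2_Y m + d *\<^sub>m K2_X L2) ** P) $ i $ j" for i j
      unfolding P(4)[unfolded X] ..
    have "P $ 1 $ 1 * K2_Y l $ 1 $ 1 = P $ 1 $ 1 * K2_Y m $ 1 $ 1"
      using entry[of 1 1] False L1 zero
      by (cases l; cases m) (simp_all add: A2_matrix_def entrywise)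
    then have ev: "K2_Y l $ 1 $ 1 = K2_Y m $ 1 $ 1"
      using nz by simp
    \<comment> \<open>The common (1,1) entry leaves only \<open>L2\<close> against
      \<open>L4 (- 1/3)\<close> and \<open>L3\<close> against \<open>L4 (- 2/3)\<close> to separate.
      For a = - 1/3 the terms with \<open>P $ 1 $ 3\<close> cancel here, so the (1,3) entries of the
      two \<open>K2_Y\<close> vanish together. For a = - 2/3 the (3,2) entries below behave
      likewise.\<close>
    moreover have "P $ 1 $ 1 * K2_Y l $ 1 $ 3 + P $ 1 $ 3 * K2_Y l $ 3 $ 3
        = K2_Y m $ 1 $ 1 * P $ 1 $ 3 + K2_Y m $ 1 $ 3 * P $ 3 $ 3"
      using entry[of 1 3] False L1 zero
      by (cases l; cases m) (simp_all add: A2_matrix_def entrywise)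
    moreover have "P $ 3 $ 2 * K2_Y l $ 2 $ 2 + P $ 3 $ 3 * K2_Y l $ 3 $ 2
        = K2_Y m $ 3 $ 2 * P $ 2 $ 2 + K2_Y m $ 3 $ 3 * P $ 3 $ 2"
      using entry[of 3 2] False L1 zero
      by (cases l; cases m) (simp_all add: A2_matrix_def entrywise)
    ultimately show ?thesis
      using False L1 nz
      by (cases l; cases m) (auto simp: A2_matrix_def)
  qed
qed

section \<open>Nilpotency of X and its Jordan form\<close>

text \<open>By Cayley-Hamilton and Newton's identity for the second elementary symmetric function
  \<open>e\<close> of the eigenvalues, the cube of \<open>N\<close> is \<open>det N\<close> times
  the identity. Taking traces gives \<open>det N = 0\<close>.\<close>

lemma traces_zero_imp_cube_zero:
  fixes N :: mat3
  assumes "trace N = 0" "trace (N ** N) = 0" "trace (N ** N ** N) = 0"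
  shows "N ** N ** N = 0"
proof -
  define e where "e = N $ 1 $ 1 * N $ 2 $ 2 - N $ 1 $ 2 * N $ 2 $ 1 + N $ 1 $ 1 * N $ 3 $ 3
    - N $ 1 $ 3 * N $ 3 $ 1 + N $ 2 $ 2 * N $ 3 $ 3 - N $ 2 $ 3 * N $ 3 $ 2"
  have "N ** N ** N = trace N *\<^sub>m (N ** N) + (- e) *\<^sub>m N + det N *\<^sub>m mat 1"
    by (simp add: entrywise trace_def det_3 e_def mat_def algebra_simps)
  moreover have "2 * e = trace N * trace N - trace (N ** N)"
    by (simp add: entrywise trace_def e_def algebra_simps)
  ultimately have eq: "N ** N ** N = det N *\<^sub>m mat 1"
    using assms by simp
  then have "trace (N ** N ** N) = 3 * det N"
    by (simp add: trace_def sum_3 mscale_def mat_def)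
  then show ?thesis using eq assms(3) by simp
qed

lemma K2_pair_nilpotent:
  assumes "K2_pair X Y"
  shows "X ** X ** X = 0"
proof (rule traces_zero_imp_cube_zero)
  show "trace X = 0" by (rule K2_pair_trace[OF assms])
  have X: "X = X ** Y - Y ** X" using assms by (simp add: K2_pair_def lie_bracket_def)
  \<comment> \<open>For \<open>Z\<close> commuting with \<open>X\<close>, the trace of Z[X, Y]
    vanishes by cyclicity. The powers \<open>Z = X\<close> and \<open>Z = X ** X\<close> give the
    two remaining traces.\<close>
  have "trace (Z ** X) = 0" if "Z ** X = X ** Z" for Z
  proof -
    have "trace (Z ** X) = trace (Z ** X ** Y) - trace (Z ** Y ** X)"
      by (subst (1) X) (simp add: matrix_mult_diff matrix_mul_assoc trace_sub)
    also have "trace (Z ** Y ** X) = trace (Z ** X ** Y)"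
      unfolding that trace_mul_sym[of "Z ** Y"] by (simp add: matrix_mul_assoc)
    finally show ?thesis by simp
  qed
  from this[of X] this[of "X ** X"] show "trace (X ** X) = 0" "trace (X ** X ** X) = 0"
    by (simp_all add: matrix_mul_assoc)
qed

definition matrix_of_columns :: "complex^3 \<Rightarrow> complex^3 \<Rightarrow> complex^3 \<Rightarrow> mat3"
  where "matrix_of_columns u v w = transpose (vector [u, v, w])"

lemma mult_matrix_of_columns:
  "N ** matrix_of_columns u v w = matrix_of_columns (N *v u) (N *v v) (N *v w)"
  by (simp add: entrywise matrix_of_columns_def transpose_def matrix_vector_mult_def)

lemma matrix_of_columns_mult_vec:
  "matrix_of_columns u v w *v x = x $ 1 *s u + x $ 2 *s v + x $ 3 *s w"
  by (simp add: entrywise matrix_of_columns_def transpose_def matrix_vector_mult_def algebra_simps)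

lemma det_matrix_of_columns_nonzero:
  assumes "\<And>a b c. a *s u + b *s v + c *s w = 0 \<Longrightarrow> a = 0 \<and> b = 0 \<and> c = 0"
  shows "det (matrix_of_columns u v w) \<noteq> 0"
proof -
  have "x = 0" if "matrix_of_columns u v w *v x = 0" for x
    using assms[of "x $ 1" "x $ 2" "x $ 3"] that
    unfolding matrix_of_columns_mult_vec vec_eq_iff[of x] forall_3 by simp
  then show ?thesis
    using matrix_left_invertible_ker invertible_det_nz invertible_left_inverse by blast
qed

text \<open>The columns of \<open>P\<close> form a Jordan basis, and the label \<open>l\<close>
  records only the Jordan type: \<open>L1\<close> for one block of size 3, \<open>L2\<close> for
  blocks of sizes 2 and 1.\<close>

lemma nilpotent_normal_form:
  fixes N :: mat3
  assumes "N \<noteq> 0" "N ** N ** N = 0"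
  obtains P l where "det P \<noteq> 0" "N ** P = P ** K2_X l"
proof (cases "N ** N = 0")
  case False
  then obtain v where "(N ** N) *v v \<noteq> 0" by (metis matrix_eq matrix_vector_mult_0)
  define u where "u = N *v v"
  define t where "t = N *v u"
  have t0: "t \<noteq> 0" using \<open>(N ** N) *v v \<noteq> 0\<close> by (simp add: t_def u_def matrix_vector_mul_assoc)
  have Nt: "N *v t = 0"
    using assms(2) by (simp add: t_def u_def matrix_vector_mul_assoc matrix_mul_assoc)
  \<comment> \<open>The Jordan chain N^2 v, N v, v is a basis: applying \<open>N\<close> repeatedly
    to a linear relation isolates one coefficient at a time.\<close>
  have "det (matrix_of_columns t u v) \<noteq> 0"
  proof (rule det_matrix_of_columns_nonzero)
    fix a b c assume eq: "a *s t + b *s u + c *s v = 0"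
    have N_lincomb: "N *v (a *s x + b *s y + c *s z) = a *s (N *v x) + b *s (N *v y) + c *s (N *v z)"
      for a b c x y z
      by (simp add: matrix_vector_right_distrib vector_scalar_commute)
    have eq1: "b *s t + c *s u = 0"
      using arg_cong[OF eq, of "\<lambda>x. N *v x"] unfolding N_lincomb
      by (simp add: Nt flip: t_def u_def)
    have "c *s t = 0"
      using arg_cong[OF eq1, of "\<lambda>x. N *v x"] 
      by (simp add: matrix_vector_right_distrib vector_scalar_commute Nt flip: t_def u_def)
    then show "a = 0 \<and> b = 0 \<and> c = 0" using eq eq1 t0 by auto
  qed
  moreover have "N ** matrix_of_columns t u v = matrix_of_columns t u v ** K2_X L1"
    unfolding mult_matrix_of_columns Nt
    by (simp add: entrywise matrix_of_columns_def transpose_def A2_matrix_def flip: t_def u_def)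
  ultimately show thesis using that by blast
next
  case True
  obtain v where "N *v v \<noteq> 0" using assms(1) by (metis matrix_eq matrix_vector_mult_0)
  define u where "u = N *v v"
  have u0: "u \<noteq> 0" using \<open>N *v v \<noteq> 0\<close> by (simp add: u_def)
  have Nu: "N *v u = 0" using True by (simp add: u_def matrix_vector_mul_assoc)
  have uv: "a = 0 \<and> b = 0" if eq: "a *s u + b *s v = 0" for a b
  proof -
    have "b *s u = 0"
      using arg_cong[OF eq, of "\<lambda>x. N *v x"]
      by (simp add: matrix_vector_right_distrib vector_scalar_commute Nu flip: u_def)
    then show ?thesis using eq u0 by auto
  qed
  obtain w where w: "w \<notin> vec.span {u, v}"
  proof -
    have "vec.dim (vec.span {u, v}) \<le> card {u, v}"
      by (simp add: vec.dim_le_card')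
    also have "\<dots> \<le> 2" by (simp add: card_insert_if)
    finally have "vec.dim (vec.span {u, v}) < vec.dim (UNIV :: (complex^3) set)"
      unfolding vec_dim_card by simp
    then have "vec.span {u, v} \<noteq> UNIV" by (metis less_irrefl)
    then show thesis using that by blast
  qed
  have uvw: "a = 0 \<and> b = 0 \<and> c = 0" if eq: "a *s u + b *s v + c *s w = 0" for a b c
  proof -
    have "c = 0"
    proof (rule ccontr)
      assume "c \<noteq> 0"
      have "w $ i = (- a / c) * u $ i + (- b / c) * v $ i" for i
      proof -
        have "a * u $ i + b * v $ i + c * w $ i = 0" using eq by (simp add: vec_eq_iff)
        then have "c * w $ i = - a * u $ i - b * v $ i" by algebra
        then show ?thesis using \<open>c \<noteq> 0\<close> by (simp add: divide_simps mult.commute)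
      qed
      then have "w = (- a / c) *s u + (- b / c) *s v" by (simp add: vec_eq_iff)
      then show False using w
        by (metis vec.span_add vec.span_scale vec.span_base insertI1 insertI2)
    qed
    then show ?thesis using eq uv by auto
  qed
  define Q where "Q = matrix_of_columns u v w"
  have detQ: "det Q \<noteq> 0" unfolding Q_def by (rule det_matrix_of_columns_nonzero) (rule uvw)
  \<comment> \<open>\<open>x\<close> holds the coordinates of \<open>N *v w\<close> in the basis u,
    v, w.\<close>
  define x where "x = matrix_inv Q *v (N *v w)"
  have "Q *v x = N *v w"
    by (simp add: x_def matrix_vector_mul_assoc matrix_mul_assoc matrix_inv_inverse[OF detQ])
  then have Nw: "N *v w = x $ 1 *s u + x $ 2 *s v + x $ 3 *s w"
    by (simp add: Q_def matrix_of_columns_mult_vec)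
  \<comment> \<open>Expanding N^2 w = 0 in the basis leaves only the \<open>u\<close> coordinate of
    \<open>N *v w\<close>.\<close>
  have "0 = N *v (N *v w)" using True by (simp add: matrix_vector_mul_assoc)
  also have "\<dots> = N *v (x $ 1 *s u + x $ 2 *s v + x $ 3 *s w)" by (simp only: Nw)
  also have "\<dots> = x $ 2 *s u + x $ 3 *s (N *v w)"
    by (simp add: matrix_vector_right_distrib vector_scalar_commute Nu flip: u_def)
  also have "\<dots> = (x $ 2 + x $ 3 * x $ 1) *s u + (x $ 3 * x $ 2) *s v + (x $ 3 * x $ 3) *s w"
    unfolding Nw by (simp add: vec_eq_iff algebra_simps)
  finally have "x $ 2 + x $ 3 * x $ 1 = 0 \<and> x $ 3 * x $ 2 = 0 \<and> x $ 3 * x $ 3 = 0"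
    using uvw by metis
  then have "x $ 2 = 0" "x $ 3 = 0" by auto
  then have Nw: "N *v w = x $ 1 *s u" using Nw by simp
  \<comment> \<open>Since \<open>N *v v = u\<close>, this correction moves \<open>w\<close> into the
    kernel of \<open>N\<close>.\<close>
  define w' where "w' = w - x $ 1 *s v"
  have Nw': "N *v w' = 0"
    by (simp add: w'_def matrix_vector_mult_diff_distrib vector_scalar_commute Nw flip: u_def)
  have "det (matrix_of_columns u v w') \<noteq> 0"
  proof (rule det_matrix_of_columns_nonzero)
    fix a b c assume "a *s u + b *s v + c *s w' = 0"
    then have "a *s u + (b - c * x $ 1) *s v + c *s w = 0"
      by (simp add: w'_def vec_eq_iff algebra_simps)
    from uvw[OF this] show "a = 0 \<and> b = 0 \<and> c = 0" by simp
  qed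
  moreover have "N ** matrix_of_columns u v w' = matrix_of_columns u v w' ** K2_X L2"
    unfolding mult_matrix_of_columns Nu Nw'
    by (simp add: entrywise matrix_of_columns_def transpose_def A2_matrix_def flip: u_def)
  ultimately show thesis using that by blast
qed

section \<open>Normalizing Y for X in Jordan form\<close>

lemma K2_pair_conjugate:
  assumes "K2_pair X Y" "det P \<noteq> 0" and X': "X ** P = P ** X'"
  obtains Y' where "K2_pair X' Y'" "Y ** P = P ** Y'"
proof -
  let ?Q = "matrix_inv P"
  note PQ = matrix_inv_inverse[OF assms(2)]
  define Y' where "Y' = ?Q ** Y ** P"
  have Y': "Y ** P = P ** Y'" by (simp add: Y'_def matrix_mul_assoc PQ)
  have cancel: "A = B" if "P ** A = P ** B" for A B
    using arg_cong[OF that, of "\<lambda>A. ?Q ** A"] by (simp add: matrix_mul_assoc PQ)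
  have "P ** lie_bracket X' Y' = lie_bracket X Y ** P"
    unfolding lie_bracket_def matrix_mult_diff
    by (metis X' Y' matrix_mul_assoc)
  then have "P ** lie_bracket X' Y' = P ** X'"
    using assms(1) X' by (simp add: K2_pair_def)
  then have "lie_bracket X' Y' = X'" by (rule cancel)
  moreover have "X' \<noteq> 0"
  proof
    assume "X' = 0"
    then have "X ** P ** ?Q = 0" using X' by simp
    then show False using assms(1) by (simp add: K2_pair_def PQ flip: matrix_mul_assoc)
  qed
  moreover have "trace Y' = trace (P ** (?Q ** Y))"
    unfolding Y'_def by (rule trace_mul_sym)
  then have "trace Y' = 0"
    using assms(1) by (simp add: matrix_mul_assoc PQ K2_pair_def)
  ultimately have "K2_pair X' Y'" by (simp add: K2_pair_def)
  then show thesis using Y' that by blast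
qed

lemma normal_form_square_nonzero:
  assumes "K2_pair (K2_X L1) M"
  obtains P d where "det P \<noteq> 0" "K2_X L1 ** P = P ** K2_X L1"
    "M ** P = P ** (K2_Y L1 + d *\<^sub>m K2_X L1)"
proof -
  \<comment> \<open>\<open>M\<close> will turn out to be upper triangular with diagonal -1, 0, 1.
    \<open>P\<close> commutes with \<open>x1 + x2\<close> and removes the corner entry; the divisor
    2 is the difference of the eigenvalues 1 and -1. What remains off the diagonal is a multiple of
    \<open>x1 + x2\<close>.\<close>
  define P :: mat3 where
    "P = vector [vector [1, 0, M $ 1 $ 3 / 2], vector [0, 1, 0], vector [0, 0, 1]]"
  have br: "lie_bracket (K2_X L1) M = K2_X L1" and tr: "trace M = 0"
    using assms by (auto simp: K2_pair_def)
  have M: "M $ 2 $ 1 = 0" "M $ 3 $ 1 = 0" "M $ 3 $ 2 = 0" "M $ 2 $ 2 = M $ 1 $ 1 + 1"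
    "M $ 3 $ 3 = M $ 2 $ 2 + 1" "M $ 2 $ 3 = M $ 1 $ 2"
    using br by (auto simp: entrywise A2_matrix_def lie_bracket_def algebra_simps)
  have M11: "M $ 1 $ 1 = - 1"
  proof -
    have "M $ 1 $ 1 + M $ 2 $ 2 + M $ 3 $ 3 = 0" using tr by (simp add: trace_def sum_3)
    then have "3 * (M $ 1 $ 1 + 1) = 0" using M by algebra
    then have "M $ 1 $ 1 + 1 = 0" by (metis mult_eq_0_iff zero_neq_numeral)
    then show ?thesis by (simp only: eq_neg_iff_add_eq_0)
  qed
  show thesis
  proof (rule that)
    show "det P \<noteq> 0" by (simp add: P_def det_3)
    show "K2_X L1 ** P = P ** K2_X L1" by (simp add: P_def entrywise A2_matrix_def)
    show "M ** P = P ** (K2_Y L1 + (M $ 1 $ 2) *\<^sub>m K2_X L1)"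
      using M by (simp add: P_def entrywise A2_matrix_def M11)
  qed
qed

lemma normal_form_square_zero:
  assumes "K2_pair (K2_X L2) M"
  obtains P l c d where "det P \<noteq> 0" "c \<noteq> 0" "K2_X L2 ** P = P ** (c *\<^sub>m K2_X l)"
    "M ** P = P ** (K2_Y l + d *\<^sub>m K2_X l)"
proof -
  define a p q r where "a = M $ 1 $ 1" and "p = M $ 1 $ 3" and "q = M $ 3 $ 2" and "r = M $ 1 $ 2"
  have br: "lie_bracket (K2_X L2) M = K2_X L2" and tr: "trace M = 0"
    using assms by (auto simp: K2_pair_def)
  have M0: "M $ 2 $ 1 = 0" "M $ 3 $ 1 = 0" "M $ 2 $ 3 = 0" "M $ 2 $ 2 = a + 1"
    using br by (auto simp: entrywise A2_matrix_def lie_bracket_def algebra_simps a_def)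
  moreover have "M $ 3 $ 3 = - (2 * a + 1)"
    using tr M0 by (simp add: trace_def sum_3 a_def eq_neg_iff_add_eq_0 algebra_simps)
  ultimately have M: "M = vector [vector [a, r, p], vector [0, a + 1, 0], vector [0, q, - (2 * a + 1)]]"
    by (simp add: entrywise a_def p_def q_def r_def)
  \<comment> \<open>Each invertible member of this family commutes with \<open>x1\<close> up to the
    factor \<open>v / u\<close>. Here \<open>u\<close> and \<open>v\<close> rescale \<open>p\<close>
    and \<open>q\<close>, while \<open>s\<close> and \<open>t\<close> eliminate them where possible.
    The (1,2) entry of \<open>M\<close> is left to the multiple \<open>d\<close> of
    \<open>x1\<close>.\<close>
  define P :: "complex \<Rightarrow> complex \<Rightarrow> complex \<Rightarrow> complex \<Rightarrow> mat3" where
    "P = (\<lambda>u v s t. vector [vector [u, 0, s], vector [0, v, 0], vector [0, t, 1]])"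
  have detP: "det (P u v s t) \<noteq> 0" if "u \<noteq> 0" "v \<noteq> 0" for u v s t
    using that by (simp add: P_def det_3)
  have PX: "K2_X L2 ** P u v s t = P u v s t ** ((v / u) *\<^sub>m K2_X L2)" if "u \<noteq> 0" for u v s t
    using that by (simp add: P_def entrywise A2_matrix_def)
  \<comment> \<open>The entry \<open>p\<close> couples the eigenvalues a and - (2a + 1), and
    \<open>q\<close> couples a + 1 and - (2a + 1). A nonzero coupling cannot be eliminated exactly
    when its two eigenvalues coincide.\<close>
  consider "a = - 1/3" "p \<noteq> 0" | "a = - 2/3" "q \<noteq> 0"
    | "a = - 1/3 \<longrightarrow> p = 0" "a = - 2/3 \<longrightarrow> q = 0" by blast
  then show thesis
  proof cases
    case 1
    show thesis
    proof (rule that)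
      \<comment> \<open>\<open>u = - p\<close> turns the coupling \<open>p\<close> into -1, the
        (1,3) entry of \<open>x3\<close>; \<open>t = q\<close> is \<open>q / (3 * a + 2)\<close> at
        a = - 1/3 and removes \<open>q\<close>.\<close>
      show "det (P (- p) 1 0 q) \<noteq> 0" by (rule detP) (use 1 in auto)
      show "1 / (- p) \<noteq> 0" using 1 by simp
      show "K2_X L2 ** P (- p) 1 0 q = P (- p) 1 0 q ** ((1 / (- p)) *\<^sub>m K2_X L2)"
        by (rule PX) (use 1 in auto)
      show "M ** P (- p) 1 0 q = P (- p) 1 0 q ** (K2_Y L2 + (- (r + p * q) / p) *\<^sub>m K2_X L2)"
        unfolding M 1(1) using 1(2) by (simp add: P_def entrywise A2_matrix_def field_simps)
    qed
  next
    case 2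
    show thesis
    proof (rule that)
      \<comment> \<open>\<open>v = 1 / q\<close> turns \<open>q\<close> into 1, the (3,2) entry of
        \<open>y2\<close>; \<open>s = p\<close> is \<open>- p / (3 * a + 1)\<close> at a = - 2/3 and
        removes \<open>p\<close>.\<close>
      show "det (P 1 (1 / q) p 0) \<noteq> 0" by (rule detP) (use 2 in auto)
      show "(1 / q) / 1 \<noteq> 0" using 2 by simp
      show "K2_X L2 ** P 1 (1 / q) p 0 = P 1 (1 / q) p 0 ** (((1 / q) / 1) *\<^sub>m K2_X L3)"
        using PX[of 1 "1 / q" p 0] by simp
      show "M ** P 1 (1 / q) p 0 = P 1 (1 / q) p 0 ** (K2_Y L3 + (r / q - p) *\<^sub>m K2_X L3)"
        unfolding M 2(1) using 2(2) by (simp add: P_def entrywise A2_matrix_def field_simps)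
    qed
  next
    case 3
    \<comment> \<open>These solve the linear equations that make the (1,3) and (3,2) entries vanish.
      If a denominator is 0, so is the numerator, and the value 0 of the division still solves the
      equation.\<close>
    define s where "s = - p / (3 * a + 1)"
    define t where "t = q / (3 * a + 2)"
    have s: "a * s + p = s * (- (2 * a + 1))"
    proof (cases "3 * a + 1 = 0")
      case True
      then have "a = - 1/3" by (simp add: field_simps eq_neg_iff_add_eq_0)
      then show ?thesis using 3 by (simp add: s_def)
    next
      case False
      then have "s * (3 * a + 1) = - p" by (simp add: s_def)
      then show ?thesis by algebra
    qed
    have t: "q + (- (2 * a + 1)) * t = t * (a + 1)"
    proof (cases "3 * a + 2 = 0")
      case True
      then have "a = - 2/3" by (simp add: field_simps eq_neg_iff_add_eq_0)
      then show ?thesis using 3 by (simp add: t_def)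
    next
      case False
      then have "q = t * (3 * a + 2)" by (simp add: t_def)
      then show ?thesis by (simp add: algebra_simps)
    qed
    show thesis
    proof (rule that)
      show "det (P 1 1 s t) \<noteq> 0" by (rule detP) auto
      show "1 / 1 \<noteq> (0 :: complex)" by simp
      show "K2_X L2 ** P 1 1 s t = P 1 1 s t ** ((1 / 1) *\<^sub>m K2_X (L4 a))"
        using PX[of 1 1 s t] by simp
      show "M ** P 1 1 s t = P 1 1 s t ** (K2_Y (L4 a) + (r + p * t) *\<^sub>m K2_X (L4 a))"
        using s t by (simp add: M P_def entrywise A2_matrix_def)
    qed
  qed
qed

section \<open>The classification\<close>

lemma K2_pair_span_equivalent:
  assumes "K2_pair X Y"
  shows "\<exists>l. mat3.span {X, Y} \<sim>\<^sub>L K2_sub l"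
proof -
  have "X \<noteq> 0" using assms by (simp add: K2_pair_def)
  then obtain P l where P: "det P \<noteq> 0" "X ** P = P ** K2_X l"
    using nilpotent_normal_form K2_pair_nilpotent[OF assms] by blast
  from K2_pair_conjugate[OF assms P] obtain M where
    M: "K2_pair (K2_X l) M" "Y ** P = P ** M" by blast
  obtain R m c d where R: "det R \<noteq> 0" "c \<noteq> 0" "K2_X l ** R = R ** (c *\<^sub>m K2_X m)"
    "M ** R = R ** (K2_Y m + d *\<^sub>m K2_X m)"
  proof (cases "l = L1")
    case True
    from normal_form_square_nonzero[OF M(1)[unfolded True]] show thesis
      using that[where m=L1 and c=1] True by (metis mat3.scale_one zero_neq_one)
  next
    case False
    then have "K2_X l = K2_X L2" by (cases l) simp_all
    then show thesis using normal_form_square_zero[of M] M(1) that by metis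
  qed
  have "mat3.span {X, Y} \<sim>\<^sub>L mat3.span {K2_X m, K2_Y m}"
  proof (rule equivalent_spanI)
    show "det (P ** R) \<noteq> 0" using P R by (simp add: det_mul)
    show "c \<noteq> 0" by fact
    show "X ** (P ** R) = (P ** R) ** (c *\<^sub>m K2_X m)" by (metis P(2) R(3) matrix_mul_assoc)
    show "Y ** (P ** R) = (P ** R) ** (K2_Y m + d *\<^sub>m K2_X m)"
      by (metis M(2) R(4) matrix_mul_assoc)
  qed
  then show ?thesis unfolding K2_sub_eq_span by blast
qed

theorem theorem6p3:
  shows "(\<forall>l. lie_subalgebra (K2_sub l) \<and> isomorphic_K2 (K2_sub l)) \<and>
    (\<forall>S. lie_subalgebra S \<and> isomorphic_K2 S \<longrightarrow> (\<exists>l. S \<sim>\<^sub>L K2_sub l)) \<and>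
    (\<forall>l m. l \<noteq> m \<longrightarrow> \<not> K2_sub l \<sim>\<^sub>L K2_sub m) \<and>
    (\<forall>\<alpha> \<beta>. K2_sub (L4 \<alpha>) \<sim>\<^sub>L K2_sub (L4 \<beta>) \<longleftrightarrow> \<alpha> = \<beta>)"
proof (intro conjI allI impI)
  fix l show "lie_subalgebra (K2_sub l)" "isomorphic_K2 (K2_sub l)"
    unfolding K2_sub_eq_span by (simp_all only: lie_subalgebra_span isomorphic_K2_span K2_pair_label)
next
  fix S assume "lie_subalgebra S \<and> isomorphic_K2 S"
  then show "\<exists>l. S \<sim>\<^sub>L K2_sub l"
    using isomorphic_K2_obtain K2_pair_span_equivalent by metis
next
  fix l m :: K2_label assume "l \<noteq> m"
  then show "\<not> K2_sub l \<sim>\<^sub>L K2_sub m" using K2_sub_equivalent_imp_eq by blast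
next
  fix \<alpha> \<beta>
  \<comment> \<open>Reflexivity, by the identity matrix, is the converse direction of the last
    claim.\<close>
  have "K2_sub (L4 \<alpha>) \<sim>\<^sub>L K2_sub (L4 \<alpha>)"
    unfolding K2_sub_eq_span by (rule equivalent_spanI[where P="mat 1" and c=1 and d=0]) simp_all
  then show "K2_sub (L4 \<alpha>) \<sim>\<^sub>L K2_sub (L4 \<beta>) \<longleftrightarrow> \<alpha> = \<beta>"
    using K2_sub_equivalent_imp_eq by blast
qed

end
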